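(* Let $\alpha\in\mathbb R$. For $A\in[0,\infty]$, the inequality \[ \sup_{n\ge1}\Big|\sum_{k=n}^\infty\frac{x_k}k\Big|n^\alpha\le A\sup_{k\ge1}|x_k|k^\alpha \] holds for all real sequences $x\in\mathcal D(C^* )$ if and only if it holds for all nonnegative sequences $x\in\mathcal D(C^* )$, if and only if it holds for all nonnegative, nonincreasing sequences $x\in\mathcal D(C^* )$. The best (least) constant $A\in[0,\infty]$ for these is \[ A=\begin{cases} \infty,&\alpha\le0;\\ \zeta(\alpha+1),&\alpha>0.\end{cases} \] Except for the zero sequence, there are no nonnegative, nondecreasing sequences in $\mathcal D(C^* )$. The inequality holds for the zero sequence $x$ with best constant $A=0$.
   Context: Sequences are indexed by the positive integers; suprema take values in $[0,\infty]$. $\mathcal D(C^* )$ is the set of all real sequences $x$ for which $\sum_{k=1}^\infty\frac{x_k}k$ converges (possibly conditionally) in $\mathbb R$. $\zeta$ is the Riemann zeta function. Convention: $\infty\cdot0=0$. *)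

theory Defs
  imports "HOL-Analysis.Analysis"
begin

text \<open>
  A sequence indexed by the positive integers is a function of type \<^typ>\<open>nat \<Rightarrow> real\<close>
  whose value at \<open>0\<close> is never used.
\<close>

definition dom_Cstar :: "(nat \<Rightarrow> real) set" where
  "dom_Cstar = {x. summable (\<lambda>k. x (Suc k) / real (Suc k))}"

text \<open>The tail \<open>\<Sum>k=n..\<infinity>. x k / k\<close>, written with \<open>k = n + j\<close>; used for \<open>n \<ge> 1\<close> only.\<close>

definition Cstar :: "(nat \<Rightarrow> real) \<Rightarrow> nat \<Rightarrow> real" where
  "Cstar x n = (\<Sum>j. x (n + j) / real (n + j))"

definition wsup :: "real \<Rightarrow> (nat \<Rightarrow> real) \<Rightarrow> ennreal" where
  "wsup \<alpha> y = (SUP n\<in>{1..}. ennreal (\<bar>y n\<bar> * real n powr \<alpha>))"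

definition nonneg_seq :: "(nat \<Rightarrow> real) \<Rightarrow> bool" where
  "nonneg_seq x \<longleftrightarrow> (\<forall>k\<ge>1. 0 \<le> x k)"

definition nonincreasing_seq :: "(nat \<Rightarrow> real) \<Rightarrow> bool" where
  "nonincreasing_seq x \<longleftrightarrow> antimono_on {1..} x"

definition nondecreasing_seq :: "(nat \<Rightarrow> real) \<Rightarrow> bool" where
  "nondecreasing_seq x \<longleftrightarrow> mono_on {1..} x"

definition zero_seq :: "(nat \<Rightarrow> real) \<Rightarrow> bool" where
  "zero_seq x \<longleftrightarrow> (\<forall>k\<ge>1. x k = 0)"

text \<open>The product is taken in \<^typ>\<open>ennreal\<close>, where \<open>\<infinity> * 0 = 0\<close>.\<close>

definition ineq_on :: "real \<Rightarrow> (nat \<Rightarrow> real) set \<Rightarrow> ennreal \<Rightarrow> bool" where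
  "ineq_on \<alpha> X A \<longleftrightarrow> (\<forall>x\<in>X. wsup \<alpha> (Cstar x) \<le> A * wsup \<alpha> x)"

definition best_constant :: "real \<Rightarrow> (nat \<Rightarrow> real) set \<Rightarrow> ennreal \<Rightarrow> bool" where
  "best_constant \<alpha> X A \<longleftrightarrow> ineq_on \<alpha> X A \<and> (\<forall>B. ineq_on \<alpha> X B \<longrightarrow> A \<le> B)"

text \<open>The Riemann zeta function on the half-line \<open>s > 1\<close>, given by its Dirichlet series.
  For \<open>s \<le> 1\<close> the series diverges and the value is meaningless.\<close>

definition riemann_zeta :: "real \<Rightarrow> real" where
  "riemann_zeta s = (\<Sum>n. 1 / real (Suc n) powr s)"

end

theory Submission
  imports Defs
begin

text \<open>
  All three families of sequences lie between the cone of nonnegative, nonincreasing sequences and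
  the whole domain. It therefore suffices to prove the inequality with the claimed constant on the
  domain, and to show that on the cone no smaller constant works: then each of the three
  inequalities holds with \<open>A\<close> exactly when \<open>A\<close> is at least the claimed constant.

  For \<open>\<alpha> > 0\<close>, if \<open>\<bar>x k\<bar> \<le> M * k powr -\<alpha>\<close>, then the weighted tail at \<open>n\<close> is at most
  \<open>M * (\<Sum>k\<ge>n. n powr \<alpha> * k powr -(\<alpha> + 1))\<close>. This is a Riemann sum of step \<open>1/n\<close> for the
  integral of \<open>t powr -(\<alpha> + 1)\<close> over \<open>t \<ge> 1\<close>. Cutting the range of \<open>k\<close> into
  blocks \<open>n * m \<le> k < n * (m + 1)\<close> and bounding each term by the first one in its block
  turns it into the zeta series, that is, into the case \<open>n = 1\<close>
  (\<open>weighted_zeta_tail_le\<close>). The sequence \<open>k powr -\<alpha>\<close> attains equality at \<open>n = 1\<close>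
  (\<open>riemann_zeta_le_constant\<close>).

  For \<open>\<alpha> \<le> 0\<close>, the indicators of \<open>{1..N}\<close> have weighted supremum \<open>1\<close>, while their
  first tail is the harmonic number \<open>harm N\<close>, which is unbounded (\<open>constant_eq_top\<close>). The
  divergence of the harmonic series also excludes nonzero nondecreasing sequences.
\<close>

section \<open>Weighted suprema and the constant\<close>

lemma wsup_upper: "n \<ge> 1 \<Longrightarrow> ennreal (\<bar>y n\<bar> * real n powr \<alpha>) \<le> wsup \<alpha> y"
  unfolding wsup_def by (rule SUP_upper) simp

lemma wsup_least:
  "(\<And>n. n \<ge> 1 \<Longrightarrow> ennreal (\<bar>y n\<bar> * real n powr \<alpha>) \<le> M) \<Longrightarrow> wsup \<alpha> y \<le> M"
  unfolding wsup_def by (rule SUP_least) simp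

lemma wsup_eq_0_iff: "wsup \<alpha> y = 0 \<longleftrightarrow> zero_seq y"
proof
  assume "wsup \<alpha> y = 0"
  then have "ennreal (\<bar>y n\<bar> * real n powr \<alpha>) \<le> 0" if "n \<ge> 1" for n
    using wsup_upper[OF that, of y \<alpha>] by simp
  then show "zero_seq y"
    by (auto simp: zero_seq_def ennreal_eq_0_iff mult_le_0_iff)
next
  assume "zero_seq y"
  then have "wsup \<alpha> y \<le> 0"
    by (intro wsup_least) (simp add: zero_seq_def)
  then show "wsup \<alpha> y = 0" by simp
qed

lemma zero_seq_Cstar: "zero_seq x \<Longrightarrow> zero_seq (Cstar x)"
  by (simp add: zero_seq_def Cstar_def)

lemma zero_seq_dom_Cstar: "zero_seq x \<Longrightarrow> x \<in> dom_Cstar"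
  by (simp add: zero_seq_def dom_Cstar_def)

lemma ineq_on_mono:
  assumes "ineq_on \<alpha> X A" "Y \<subseteq> X" "A \<le> B"
  shows "ineq_on \<alpha> Y B"
  using assms unfolding ineq_on_def
  by (meson mult_right_mono order_trans subsetD zero_le)

text \<open>The right-hand side is infinite unless \<open>wsup \<alpha> x = 0\<close>, and then \<open>x\<close> and all its tails vanish.\<close>

lemma ineq_on_top: "ineq_on \<alpha> X \<infinity>"
  unfolding ineq_on_def
proof
  fix x assume "x \<in> X"
  show "wsup \<alpha> (Cstar x) \<le> \<infinity> * wsup \<alpha> x"
  proof (cases "zero_seq x")
    case True
    then have "wsup \<alpha> (Cstar x) = 0"
      using wsup_eq_0_iff zero_seq_Cstar by blast
    then show ?thesis by simp
  next
    case False
    then show ?thesis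
      using wsup_eq_0_iff[of \<alpha> x] by (simp add: ennreal_top_mult)
  qed
qed

section \<open>The zeta bound for positive exponents\<close>

lemma powr_minus_plus_1:
  fixes \<alpha> :: real
  assumes "k \<ge> (1::nat)"
  shows "real k powr -(\<alpha> + 1) = 1 / (real k powr \<alpha> * real k)"
  unfolding powr_minus_divide powr_add using assms by simp

lemma summable_inverse_powr:
  fixes \<alpha> :: real
  assumes "\<alpha> > 0"
  shows "summable (\<lambda>j. real (n + j) powr -(\<alpha> + 1))"
proof -
  have "summable (\<lambda>k. real k powr -(\<alpha> + 1))"
    using assms by (subst summable_real_powr_iff) simp
  then show ?thesis
    using summable_iff_shift[of "\<lambda>k. real k powr -(\<alpha> + 1)" n] by (simp add: add.commute)
qed

lemma riemann_zeta_eq: "riemann_zeta s = (\<Sum>j. real (1 + j) powr -s)"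
  by (simp add: riemann_zeta_def powr_minus_divide)

lemma riemann_zeta_pos:
  fixes \<alpha> :: real
  assumes "\<alpha> > 0"
  shows "riemann_zeta (\<alpha> + 1) > 0"
  unfolding riemann_zeta_eq
  by (rule suminf_pos[OF summable_inverse_powr[OF assms]]) simp

text \<open>
  There are \<open>n\<close> indices \<open>k\<close> with \<open>n * m \<le> k < n * (m + 1)\<close>, and each satisfies
  \<open>n powr \<alpha> * k powr -(\<alpha> + 1) \<le> m powr -(\<alpha> + 1) / n\<close>; so the block contributes at most the
  \<open>m\<close>-th term of the zeta series.
\<close>

lemma weighted_zeta_tail_le:
  fixes \<alpha> :: real
  assumes "\<alpha> > 0" "n \<ge> 1"
  shows "real n powr \<alpha> * (\<Sum>j. real (n + j) powr -(\<alpha> + 1)) \<le> riemann_zeta (\<alpha> + 1)"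
proof -
  define f where "f j = real n powr \<alpha> * real (n + j) powr -(\<alpha> + 1)" for j
  have "summable f"
    unfolding f_def by (intro summable_mult summable_inverse_powr assms)
  \<comment> \<open>The offset \<open>j\<close> starts at \<open>0\<close>, so block \<open>m\<close> below begins at \<open>k = n * (1 + m)\<close>.\<close>
  then have blocks: "(\<lambda>m. sum f {m * n..<m * n + n}) sums suminf f"
    using assms by (intro sums_group) auto
  have block_le: "sum f {m * n..<m * n + n} \<le> real (1 + m) powr -(\<alpha> + 1)" for m
  proof -
    have term_le: "f j \<le> real (1 + m) powr -(\<alpha> + 1) / real n" if "j \<in> {m * n..<m * n + n}" for j
    proof -
      have "n * (1 + m) \<le> n + j" using that by (simp add: algebra_simps)
      then have le: "real n * real (1 + m) \<le> real (n + j)"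
        by (metis of_nat_le_iff of_nat_mult)
      have "f j \<le> real n powr \<alpha> * (real n * real (1 + m)) powr -(\<alpha> + 1)"
        unfolding f_def using assms le by (intro mult_left_mono powr_mono2') auto
      also have "\<dots> = (real n powr \<alpha> * real n powr -(\<alpha> + 1)) * real (1 + m) powr -(\<alpha> + 1)"
        by (subst powr_mult) auto
      also have "real n powr \<alpha> * real n powr -(\<alpha> + 1) = 1 / real n"
        using assms by (simp add: powr_add[symmetric] powr_minus_divide)
      finally show ?thesis by simp
    qed
    have "sum f {m * n..<m * n + n} \<le> real (card {m * n..<m * n + n}) * (real (1 + m) powr -(\<alpha> + 1) / real n)"
      by (rule sum_bounded_above) (rule term_le)
    then show ?thesis using assms by simp
  qed
  have "suminf f \<le> riemann_zeta (\<alpha> + 1)"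
    unfolding riemann_zeta_eq
    using sums_le[OF block_le blocks summable_sums[OF summable_inverse_powr[OF assms(1)]]] .
  then show ?thesis
    unfolding f_def using summable_inverse_powr[OF assms(1)] by (simp add: suminf_mult)
qed

lemma ineq_on_riemann_zeta:
  fixes \<alpha> :: real
  assumes "\<alpha> > 0"
  shows "ineq_on \<alpha> X (ennreal (riemann_zeta (\<alpha> + 1)))"
  unfolding ineq_on_def
proof
  fix x assume "x \<in> X"
  let ?Z = "riemann_zeta (\<alpha> + 1)"
  show "wsup \<alpha> (Cstar x) \<le> ennreal ?Z * wsup \<alpha> x"
  proof (cases "wsup \<alpha> x")
    case (real M)
    have bound: "\<bar>x k / real k\<bar> \<le> M * real k powr -(\<alpha> + 1)" if "k \<ge> 1" for k
    proof -
      have "\<bar>x k\<bar> * real k powr \<alpha> \<le> M"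
        using wsup_upper[OF that, of x \<alpha>] real by (simp add: ennreal_le_iff)
      then have "\<bar>x k\<bar> \<le> M / real k powr \<alpha>"
        using that by (simp add: pos_le_divide_eq)
      then have "\<bar>x k\<bar> / real k \<le> M / real k powr \<alpha> / real k"
        by (rule divide_right_mono) simp
      then show ?thesis
        unfolding powr_minus_plus_1[OF that] by simp
    qed
    show ?thesis
    proof (rule wsup_least)
      fix n :: nat assume n: "n \<ge> 1"
      let ?t = "\<lambda>j. real (n + j) powr -(\<alpha> + 1)"
      have sm: "summable (\<lambda>j. M * ?t j)"
        by (intro summable_mult summable_inverse_powr assms)
      have le: "norm (x (n + j) / real (n + j)) \<le> M * ?t j" for j
        using bound[of "n + j"] n by simp
      have "\<bar>Cstar x n\<bar> \<le> (\<Sum>j. M * ?t j)"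
        unfolding Cstar_def using norm_suminf_le[OF le sm] by simp
      also have "\<dots> = M * (\<Sum>j. ?t j)"
        by (intro suminf_mult summable_inverse_powr assms)
      finally have "\<bar>Cstar x n\<bar> * real n powr \<alpha> \<le> M * (\<Sum>j. ?t j) * real n powr \<alpha>"
        by (rule mult_right_mono) simp
      also have "\<dots> = M * (real n powr \<alpha> * (\<Sum>j. ?t j))"
        by simp
      also have "\<dots> \<le> M * ?Z"
        using real n assms by (intro mult_left_mono weighted_zeta_tail_le) auto
      finally have "ennreal (\<bar>Cstar x n\<bar> * real n powr \<alpha>) \<le> ennreal (?Z * M)"
        by (intro ennreal_leI) (simp add: mult.commute)
      then show "ennreal (\<bar>Cstar x n\<bar> * real n powr \<alpha>) \<le> ennreal ?Z * wsup \<alpha> x"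
        using real riemann_zeta_pos[OF assms] by (simp add: ennreal_mult)
    qed
  next
    case top
    then show ?thesis
      using riemann_zeta_pos[OF assms] by (simp add: ennreal_mult_top)
  qed
qed

section \<open>Extremal nonincreasing sequences\<close>

text \<open>For every \<open>\<alpha>\<close> the weight is \<open>1\<close> at \<open>n = 1\<close>, so testing the inequality there
  isolates the unweighted first tail.\<close>

lemma first_tail_le_constant:
  assumes "ineq_on \<alpha> X B" "x \<in> X" "wsup \<alpha> x \<le> 1"
  shows "ennreal (Cstar x 1) \<le> B"
proof -
  have "ennreal (Cstar x 1) \<le> ennreal (\<bar>Cstar x 1\<bar> * real 1 powr \<alpha>)"
    by (intro ennreal_leI) simp
  also have "\<dots> \<le> wsup \<alpha> (Cstar x)"
    by (rule wsup_upper) simp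
  also have "\<dots> \<le> B * wsup \<alpha> x"
    using assms(1,2) by (simp add: ineq_on_def)
  also have "\<dots> \<le> B * 1"
    using assms(3) by (rule mult_left_mono) simp
  finally show ?thesis by simp
qed

lemma riemann_zeta_le_constant:
  fixes \<alpha> :: real
  assumes "\<alpha> > 0" "ineq_on \<alpha> {x \<in> dom_Cstar. nonneg_seq x \<and> nonincreasing_seq x} B"
  shows "ennreal (riemann_zeta (\<alpha> + 1)) \<le> B"
proof -
  define x where "x k = real k powr -\<alpha>" for k :: nat
  have quot: "x (1 + j) / real (1 + j) = real (1 + j) powr -(\<alpha> + 1)" for j
    unfolding x_def powr_minus_divide[of _ \<alpha>]
    by (subst powr_minus_plus_1) auto
  have "x \<in> dom_Cstar"
    using summable_inverse_powr[OF assms(1), of 1] quot by (simp add: dom_Cstar_def)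
  moreover have "nonneg_seq x"
    by (simp add: nonneg_seq_def x_def)
  moreover have "nonincreasing_seq x"
    unfolding nonincreasing_seq_def x_def using assms(1)
    by (intro monotone_onI powr_mono2') auto
  moreover have "wsup \<alpha> x \<le> 1"
    by (rule wsup_least) (simp add: x_def powr_add[symmetric])
  ultimately have "ennreal (Cstar x 1) \<le> B"
    by (intro first_tail_le_constant[OF assms(2)]) auto
  then show ?thesis
    unfolding Cstar_def riemann_zeta_eq quot .
qed

lemma constant_eq_top:
  fixes \<alpha> :: real
  assumes "\<alpha> \<le> 0" "ineq_on \<alpha> {x \<in> dom_Cstar. nonneg_seq x \<and> nonincreasing_seq x} B"
  shows "B = \<infinity>"
proof -
  have harm_le: "ennreal (harm N) \<le> B" for N
  proof -
    define x :: "nat \<Rightarrow> real" where "x k = (if k \<le> N then 1 else 0)" for k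
    have sums: "(\<lambda>j. x (Suc j) / real (Suc j)) sums harm N"
    proof -
      have "(\<lambda>j. x (Suc j) / real (Suc j)) sums (\<Sum>j<N. x (Suc j) / real (Suc j))"
        by (rule sums_finite) (auto simp: x_def)
      also have "(\<Sum>j<N. x (Suc j) / real (Suc j)) = harm N"
        unfolding harm_def atLeastLessThanSuc_atLeastAtMost[symmetric] One_nat_def
          sum.shift_bounds_Suc_ivl atLeast0LessThan
        by (rule sum.cong) (auto simp: x_def field_simps)
      finally show ?thesis .
    qed
    have "x \<in> dom_Cstar"
      using sums by (auto simp: dom_Cstar_def summable_def)
    moreover have "nonneg_seq x" "nonincreasing_seq x"
      by (auto simp: nonneg_seq_def nonincreasing_seq_def x_def intro: monotone_onI)
    moreover have "wsup \<alpha> x \<le> 1"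
    proof (rule wsup_least)
      fix n :: nat assume "n \<ge> 1"
      then have "real n powr \<alpha> \<le> real n powr 0"
        using assms(1) by (intro powr_mono) auto
      then show "ennreal (\<bar>x n\<bar> * real n powr \<alpha>) \<le> 1"
        using \<open>n \<ge> 1\<close> by (auto simp: x_def)
    qed
    ultimately have "ennreal (Cstar x 1) \<le> B"
      by (intro first_tail_le_constant[OF assms(2)]) auto
    also have "Cstar x 1 = harm N"
      using sums_unique[OF sums] by (simp add: Cstar_def)
    finally show ?thesis .
  qed
  show ?thesis
  proof (cases B)
    case (real b)
    obtain N where "harm N > b"
      using filterlim_at_top_dense[of "harm :: nat \<Rightarrow> real" sequentially] harm_at_top
      by (meson eventually_happens' sequentially_bot)
    then show ?thesis
      using harm_le[of N] real by (simp add: ennreal_le_iff)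
  qed simp
qed

section \<open>Nondecreasing sequences\<close>

text \<open>A positive value \<open>x m\<close> would make \<open>x m / k\<close> a summable minorant from \<open>k = m\<close> on.\<close>

lemma nondecreasing_dom_Cstar_imp_zero:
  assumes "x \<in> dom_Cstar" "nonneg_seq x" "nondecreasing_seq x"
  shows "zero_seq x"
  unfolding zero_seq_def
proof (intro allI impI)
  fix m :: nat assume m: "m \<ge> 1"
  have sm: "summable (\<lambda>k. x k / real k)"
    using assms(1) summable_Suc_iff[of "\<lambda>k. x k / real k"] by (simp add: dom_Cstar_def)
  have "summable (\<lambda>k. x m * inverse (real k))"
  proof (rule summable_comparison_test[OF _ sm], intro exI allI impI)
    fix k assume "k \<ge> m"
    then have "0 \<le> x m" "x m \<le> x k"
      using m assms(2,3) by (auto simp: nonneg_seq_def nondecreasing_seq_def monotone_on_def)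
    then show "norm (x m * inverse (real k)) \<le> x k / real k"
      by (simp add: divide_inverse mult_right_mono)
  qed
  then show "x m = 0"
    using not_summable_harmonic[where 'a = real] summable_cmult_iff[of "x m" "\<lambda>k. inverse (real k)"]
    by auto
qed

lemma nondecreasing_dom_Cstar_iff_zero:
  "x \<in> dom_Cstar \<and> nonneg_seq x \<and> nondecreasing_seq x \<longleftrightarrow> zero_seq x"
proof
  assume "zero_seq x"
  then show "x \<in> dom_Cstar \<and> nonneg_seq x \<and> nondecreasing_seq x"
    using zero_seq_dom_Cstar
    by (auto simp: zero_seq_def nonneg_seq_def nondecreasing_seq_def intro: monotone_onI)
qed (use nondecreasing_dom_Cstar_imp_zero in blast)

section \<open>The best constants\<close>

theorem theorem3p7:
  fixes \<alpha> :: real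
  defines "X1 \<equiv> dom_Cstar"
    and "X2 \<equiv> {x \<in> dom_Cstar. nonneg_seq x}"
    and "X3 \<equiv> {x \<in> dom_Cstar. nonneg_seq x \<and> nonincreasing_seq x}"
    and "A0 \<equiv> (if \<alpha> \<le> 0 then \<infinity> else ennreal (riemann_zeta (\<alpha> + 1)))"
  shows "(\<forall>A. (ineq_on \<alpha> X1 A \<longleftrightarrow> ineq_on \<alpha> X2 A) \<and> (ineq_on \<alpha> X2 A \<longleftrightarrow> ineq_on \<alpha> X3 A))
    \<and> best_constant \<alpha> X1 A0 \<and> best_constant \<alpha> X2 A0 \<and> best_constant \<alpha> X3 A0
    \<and> (\<forall>x. x \<in> dom_Cstar \<and> nonneg_seq x \<and> nondecreasing_seq x \<longleftrightarrow> zero_seq x)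
    \<and> best_constant \<alpha> {x. zero_seq x} 0"
proof -
  have upper: "ineq_on \<alpha> X1 A0"
    using ineq_on_top ineq_on_riemann_zeta by (simp add: A0_def)
  have lower: "A0 \<le> A" if "ineq_on \<alpha> X3 A" for A
    using that constant_eq_top riemann_zeta_le_constant by (auto simp: A0_def X3_def)
  have iff: "ineq_on \<alpha> X A \<longleftrightarrow> A0 \<le> A" if "X3 \<subseteq> X" "X \<subseteq> X1" for X A
    using ineq_on_mono[OF upper that(2)] ineq_on_mono[OF _ that(1) order_refl] lower by blast
  have iffs: "ineq_on \<alpha> X1 A \<longleftrightarrow> A0 \<le> A" "ineq_on \<alpha> X2 A \<longleftrightarrow> A0 \<le> A"
    "ineq_on \<alpha> X3 A \<longleftrightarrow> A0 \<le> A" for A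
    by (rule iff; auto simp: X1_def X2_def X3_def)+
  have "wsup \<alpha> (Cstar x) = 0" if "zero_seq x" for x
    using that wsup_eq_0_iff zero_seq_Cstar by blast
  then have "best_constant \<alpha> {x. zero_seq x} 0"
    by (simp add: best_constant_def ineq_on_def)
  then show ?thesis
    using nondecreasing_dom_Cstar_iff_zero by (simp add: best_constant_def iffs)
qed

end
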